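(* Let $F=\{f_i\}_{i=1}^N$ be a Parseval $K$-frame for $\mathcal{H}_n$, where $K\in\mathcal{B}(\mathcal{H}_n)$. Let $L:=\max\{\|f_i\|\,\|K^\dagger f_i\|:1\le i\le N\}$, $I_1:=\{i:\|f_i\|\,\|K^\dagger f_i\|=L\}$, $I_2:=\{1,\dots,N\}\setminus I_1$, and $V_j:=\operatorname{span}\{f_i:i\in I_j\}$ for $j=1,2$. Then the following statements are equivalent: (i) the canonical dual $\{K^\dagger f_i\}_{i=1}^N$ is the unique $1$-erasure optimal $K$-dual of $F$ under the operator norm; (ii) $V_1\cap V_2=\{0\}$ and the set $\{f_i\}_{i\in I_2}$ is linearly independent.
   Context: $\mathcal{H}_n$ is an $n$-dimensional Hilbert space (over $\mathbb{R}$ or $\mathbb{C}$) and $\mathcal{B}(\mathcal{H}_n)$ is the algebra of bounded linear operators on it. For $K\in\mathcal{B}(\mathcal{H}_n)$, a sequence $F=\{f_i\}_{i=1}^N\subset\mathcal{H}_n$ is a $K$-frame if there are constants $0<A\le B<\infty$ with $A\|K^*f\|^2\le\sum_{i=1}^N|\langle f,f_i\rangle|^2\le B\|f\|^2$ for all $f$; it is a Parseval $K$-frame if $\sum_{i=1}^N|\langle f,f_i\rangle|^2=\|K^*f\|^2$ for all $f$. A sequence $G=\{g_i\}_{i=1}^N\subset\mathcal{H}_n$ is a $K$-dual of $F$ if $Kf=\sum_{i=1}^N\langle f,g_i\rangle f_i$ for all $f\in\mathcal{H}_n$. $K^\dagger$ is the Moore–Penrose pseudoinverse of $K$; for a Parseval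 $K$-frame $F$, $\{K^\dagger f_i\}_{i=1}^N$ is a $K$-dual, called the canonical $K$-dual. For a $K$-dual $G$ of $F$, $\mathbb{O}_1(F,G):=\max_{1\le i\le N}\|f_i\|\,\|g_i\|$ (the maximum operator norm of the error operators $f\mapsto\langle f,f_i\rangle g_i$). A $K$-dual $G'$ of $F$ is $1$-erasure optimal with respect to the operator norm if $\mathbb{O}_1(F,G')=\inf\{\mathbb{O}_1(F,G):G\text{ is a }K\text{-dual of }F\}$.
   Formalization: The formal theorem assumes K ≠ 0; for K = 0 (with n, N ≥ 1) all f_i = 0, so (ii) holds, but every sequence G is a K-dual with error 0, so the canonical dual is not the unique optimal one and (i) fails. *)

theory Defs
  imports "HOL-Analysis.Analysis"
begin

text \<open>
  The scalar field is \<open>\<real>\<close> or \<open>\<complex>\<close>. The class has both as instances, with the identity and complex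
  conjugation as \<open>scalar_cnj\<close>; \<open>rc_field_cases\<close> below shows that, up to isomorphism, there are
  no other instances.
\<close>

class rc_field = real_normed_field +
  fixes scalar_cnj :: "'a \<Rightarrow> 'a"
  assumes scalar_cnj_add: "scalar_cnj (x + y) = scalar_cnj x + scalar_cnj y"
    and scalar_cnj_mult: "scalar_cnj (x * y) = scalar_cnj x * scalar_cnj y"
    and scalar_cnj_cnj: "scalar_cnj (scalar_cnj x) = x"
    and mult_scalar_cnj_scaleR: "x * scalar_cnj x = (norm x)\<^sup>2 *\<^sub>R 1"

lemma mult_scalar_cnj: "(x::'k::rc_field) * scalar_cnj x = of_real ((norm x)\<^sup>2)"
  by (simp add: mult_scalar_cnj_scaleR of_real_def)

instantiation real :: rc_field
begin
definition scalar_cnj_real :: "real \<Rightarrow> real" where "scalar_cnj_real x = x"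
instance by standard (auto simp: scalar_cnj_real_def power2_eq_square)
end

instantiation complex :: rc_field
begin
definition scalar_cnj_complex :: "complex \<Rightarrow> complex" where "scalar_cnj_complex x = cnj x"
instance by standard (auto simp: scalar_cnj_complex_def complex_norm_square[symmetric] scaleR_conv_of_real simp del: of_real_power)
end

lemma rc_field_cases:
  "(\<forall>x::'k::rc_field. x \<in> \<real> \<and> scalar_cnj x = x) \<or>
   (\<exists>i::'k. i * i = -1 \<and> scalar_cnj i = - i \<and>
      (\<forall>x. \<exists>a b. x = of_real a + of_real b * i \<and> scalar_cnj x = of_real a - of_real b * i))"
proof -
  have c0: "scalar_cnj (0::'k) = 0"
    using scalar_cnj_add[of "0::'k" 0] by simp
  have cneg: "scalar_cnj (- x) = - scalar_cnj x" for x :: 'k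
    using scalar_cnj_add[of x "- x"] c0 by (simp add: eq_neg_iff_add_eq_0 add.commute)
  have cdiff: "scalar_cnj (x - y) = scalar_cnj x - scalar_cnj y" for x y :: 'k
    using scalar_cnj_add[of x "- y"] cneg[of y] by simp
  have creal: "scalar_cnj (of_real r) = (of_real r :: 'k)" for r
  proof (cases "r = 0")
    case False
    have "(of_real r :: 'k) * scalar_cnj (of_real r) = of_real r * of_real r"
      using mult_scalar_cnj[of "of_real r :: 'k"] by (simp add: power2_eq_square)
    with False show ?thesis by simp
  qed (simp add: c0)
  have sum_real: "x + scalar_cnj x \<in> \<real>" for x :: 'k
  proof -
    have "scalar_cnj (1::'k) = 1" using creal[of 1] by simp
    then have "(1 + x) * scalar_cnj (1 + x) = 1 + (x + scalar_cnj x) + x * scalar_cnj x"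
      by (simp add: scalar_cnj_add algebra_simps)
    then have "x + scalar_cnj x = of_real ((norm (1 + x))\<^sup>2 - 1 - (norm x)\<^sup>2)"
      by (simp only: mult_scalar_cnj of_real_diff of_real_1) (simp add: algebra_simps)
    then show ?thesis by simp
  qed
  have fixed_real: "x \<in> \<real>" if "scalar_cnj x = x" for x :: 'k
  proof -
    have "x = of_real (1/2) * (x + scalar_cnj x)" by (simp add: that)
    also have "\<dots> \<in> \<real>" by (intro Reals_mult sum_real Reals_of_real)
    finally show ?thesis .
  qed
  have real_fixed: "scalar_cnj x = x" if "x \<in> \<real>" for x :: 'k
    using that creal by (auto elim: Reals_cases)
  show ?thesis
  proof (cases "\<forall>x::'k. x \<in> \<real>")
    case True
    then show ?thesis using real_fixed by blast
  next
    case False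
    then obtain x :: 'k where x: "x \<notin> \<real>" by blast
    define y where "y = x - scalar_cnj x"
    have y0: "y \<noteq> 0" using x fixed_real[of x] by (auto simp: y_def)
    have cy: "scalar_cnj y = - y" by (simp add: y_def cdiff scalar_cnj_cnj)
    define i where "i = y * of_real (inverse (norm y))"
    have ci: "scalar_cnj i = - i"
      unfolding i_def scalar_cnj_mult cy creal by simp
    have "norm i = 1" using y0 by (simp add: i_def norm_mult del: of_real_inverse)
    then have ii: "i * i = -1"
      using mult_scalar_cnj[of i] ci by (simp add: minus_equation_iff)
    have "\<exists>a b. z = of_real a + of_real b * i \<and> scalar_cnj z = of_real a - of_real b * i" for z :: 'k
    proof -
      define u where "u = z + scalar_cnj z"
      define w where "w = z - scalar_cnj z"
      have "scalar_cnj (w * i) = w * i"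
        by (simp add: scalar_cnj_mult ci w_def cdiff scalar_cnj_cnj algebra_simps)
      then obtain b where b: "w * i = of_real b" using fixed_real by (auto elim: Reals_cases)
      obtain a where a: "u = of_real a" using sum_real u_def by (auto elim: Reals_cases)
      have "w = - (w * i) * i" by (simp add: mult.assoc ii)
      then have w: "w = - of_real b * i" by (simp add: b)
      have z: "z = of_real (a/2) + of_real (- b/2) * i"
      proof -
        have "z = (u + w) / 2" by (simp add: u_def w_def)
        then show ?thesis by (simp add: a w field_simps)
      qed
      moreover have "scalar_cnj z = of_real (a/2) - of_real (- b/2) * i"
        by (subst z) (simp only: scalar_cnj_add scalar_cnj_mult creal ci, simp)
      ultimately show ?thesis by blast
    qed
    with ii ci show ?thesis by blast
  qed
qed

text \<open>
  An \<open>n\<close>-dimensional Hilbert space over \<open>'k\<close>: the norm and completeness are those of the type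
  class \<open>banach\<close>, the norm being the one induced by \<open>ip\<close>. The inner product is linear in its
  first argument.
\<close>

locale fd_hilbert_space = vector_space smul
  for smul :: "'k::rc_field \<Rightarrow> 'h::banach \<Rightarrow> 'h" +
  fixes ip :: "'h \<Rightarrow> 'h \<Rightarrow> 'k" and n :: nat
  assumes smul_of_real: "smul (of_real r) x = r *\<^sub>R x"
    and ip_add_left: "ip (x + y) z = ip x z + ip y z"
    and ip_smul_left: "ip (smul c x) z = c * ip x z"
    and ip_commute: "ip y x = scalar_cnj (ip x y)"
    and ip_self: "ip x x = of_real ((norm x)\<^sup>2)"
    and basis_exists: "\<exists>B. finite B \<and> card B = n \<and> independent B \<and> span B = UNIV"

lemma fd_hilbert_space_real:
  "fd_hilbert_space (*\<^sub>R) ((\<bullet>) :: 'a::euclidean_space \<Rightarrow> 'a \<Rightarrow> real) DIM('a)"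
proof -
  have "\<exists>B::'a set. finite B \<and> card B = DIM('a) \<and> \<not> module.dependent (*\<^sub>R) B \<and>
          module.span (*\<^sub>R) B = UNIV"
    using independent_Basis span_Basis finite_Basis
    by (metis dependent_raw_def span_raw_def)
  then show ?thesis
    by unfold_locales
       (auto simp: inner_add_left inner_add_right inner_commute scalar_cnj_real_def power2_norm_eq_inner)
qed

lemma fd_hilbert_space_complex:
  "fd_hilbert_space (*s) (\<lambda>x y::complex^'n. \<Sum>i\<in>UNIV. x $ i * cnj (y $ i)) CARD('n)"
proof -
  have "\<exists>B::(complex^'n) set. finite B \<and> card B = CARD('n) \<and> vec.independent B \<and> vec.span B = UNIV"
    using finite_cart_basis card_cart_basis independent_cart_basis span_cart_basis by blast
  moreover have "(\<Sum>i\<in>UNIV. x $ i * cnj (x $ i)) = of_real ((norm x)\<^sup>2)" for x :: "complex^'n"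
    by (simp add: norm_vec_def L2_set_def sum_nonneg complex_norm_square[symmetric] del: of_real_power)
  ultimately show ?thesis
    by unfold_locales
       (auto simp: vec_eq_iff algebra_simps sum.distrib sum_distrib_left
          scalar_cnj_complex_def scaleR_conv_of_real[where 'a = complex])
qed

definition bounded_operator :: "('k::rc_field \<Rightarrow> 'h::banach \<Rightarrow> 'h) \<Rightarrow> ('h \<Rightarrow> 'h) \<Rightarrow> bool" where
  "bounded_operator smul T \<longleftrightarrow>
     Vector_Spaces.linear smul smul T \<and> (\<exists>c. \<forall>x. norm (T x) \<le> c * norm x)"

definition adj :: "('h \<Rightarrow> 'h \<Rightarrow> 'k) \<Rightarrow> ('h \<Rightarrow> 'h) \<Rightarrow> 'h \<Rightarrow> 'h" where
  "adj ip T = (THE S. \<forall>x y. ip (T x) y = ip x (S y))"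

text \<open>The Moore--Penrose pseudoinverse, through the four Penrose equations.\<close>

definition pinv :: "('k::rc_field \<Rightarrow> 'h::banach \<Rightarrow> 'h) \<Rightarrow> ('h \<Rightarrow> 'h \<Rightarrow> 'k) \<Rightarrow> ('h \<Rightarrow> 'h) \<Rightarrow> 'h \<Rightarrow> 'h" where
  "pinv smul ip T = (THE X. bounded_operator smul X \<and>
     T \<circ> X \<circ> T = T \<and> X \<circ> T \<circ> X = X \<and> adj ip (T \<circ> X) = T \<circ> X \<and> adj ip (X \<circ> T) = X \<circ> T)"

text \<open>
  A sequence of vectors indexed by \<open>1, \<dots>, N\<close> is a function on \<open>nat\<close> whose values outside
  \<open>{1..N}\<close> are irrelevant.
\<close>

definition parseval_K_frame ::
  "('h::banach \<Rightarrow> 'h \<Rightarrow> 'k::rc_field) \<Rightarrow> ('h \<Rightarrow> 'h) \<Rightarrow> nat \<Rightarrow> (nat \<Rightarrow> 'h) \<Rightarrow> bool" where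
  "parseval_K_frame ip K N F \<longleftrightarrow>
     (\<forall>x. (\<Sum>i=1..N. (norm (ip x (F i)))\<^sup>2) = (norm (adj ip K x))\<^sup>2)"

definition K_dual ::
  "('k::rc_field \<Rightarrow> 'h::banach \<Rightarrow> 'h) \<Rightarrow> ('h \<Rightarrow> 'h \<Rightarrow> 'k) \<Rightarrow> ('h \<Rightarrow> 'h) \<Rightarrow> nat \<Rightarrow>
     (nat \<Rightarrow> 'h) \<Rightarrow> (nat \<Rightarrow> 'h) \<Rightarrow> bool" where
  "K_dual smul ip K N F G \<longleftrightarrow> (\<forall>x. K x = (\<Sum>i=1..N. smul (ip x (G i)) (F i)))"

definition op_error :: "nat \<Rightarrow> (nat \<Rightarrow> 'h::banach) \<Rightarrow> (nat \<Rightarrow> 'h) \<Rightarrow> real" where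
  "op_error N F G = Max {norm (F i) * norm (G i) | i. i \<in> {1..N}}"

definition one_erasure_optimal ::
  "('k::rc_field \<Rightarrow> 'h::banach \<Rightarrow> 'h) \<Rightarrow> ('h \<Rightarrow> 'h \<Rightarrow> 'k) \<Rightarrow> ('h \<Rightarrow> 'h) \<Rightarrow> nat \<Rightarrow>
     (nat \<Rightarrow> 'h) \<Rightarrow> (nat \<Rightarrow> 'h) \<Rightarrow> bool" where
  "one_erasure_optimal smul ip K N F G' \<longleftrightarrow> K_dual smul ip K N F G' \<and>
     op_error N F G' = Inf {op_error N F G | G. K_dual smul ip K N F G}"

definition unique_one_erasure_optimal ::
  "('k::rc_field \<Rightarrow> 'h::banach \<Rightarrow> 'h) \<Rightarrow> ('h \<Rightarrow> 'h \<Rightarrow> 'k) \<Rightarrow> ('h \<Rightarrow> 'h) \<Rightarrow> nat \<Rightarrow>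
     (nat \<Rightarrow> 'h) \<Rightarrow> (nat \<Rightarrow> 'h) \<Rightarrow> bool" where
  "unique_one_erasure_optimal smul ip K N F G' \<longleftrightarrow> one_erasure_optimal smul ip K N F G' \<and>
     (\<forall>G. one_erasure_optimal smul ip K N F G \<longrightarrow> (\<forall>i\<in>{1..N}. G i = G' i))"

text \<open>Linear independence of an indexed family, so that a repeated vector makes it dependent.\<close>

definition independent_family ::
  "('k::rc_field \<Rightarrow> 'h::banach \<Rightarrow> 'h) \<Rightarrow> (nat \<Rightarrow> 'h) \<Rightarrow> nat set \<Rightarrow> bool" where
  "independent_family smul F I \<longleftrightarrow> inj_on F I \<and> \<not> module.dependent smul (F ` I)"

end

theory Submission
  imports Defs
begin

text \<open>
  Write \<open>c i = K\<^sup>\<dagger> f i\<close>. The other \<open>K\<close>-duals are the families \<open>c + u\<close> with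
  \<open>\<Sum>i. \<langle>x, u i\<rangle> f i = 0\<close> for all \<open>x\<close>. Such a \<open>u\<close> is orthogonal to \<open>c\<close> in the space of families:
  applying \<open>K\<^sup>\<dagger>\<close> shows that the operator \<open>x \<mapsto> \<Sum>i. \<langle>x, u i\<rangle> c i\<close> is zero, and \<open>\<Sum>i. \<langle>c i, u i\<rangle>\<close> is its
  trace. Hence \<open>\<Sum>i. \<parallel>c i + u i\<parallel>\<^sup>2 = \<Sum>i. \<parallel>c i\<parallel>\<^sup>2 + \<Sum>i. \<parallel>u i\<parallel>\<^sup>2\<close> (\<open>dual_pythagoras\<close>).

  Assume (ii). The relation between the \<open>f i\<close> splits into one over \<open>I1\<close> and one over \<open>I2\<close> because
  the spans meet only in \<open>0\<close>, and independence gives \<open>u = 0\<close> on \<open>I2\<close>. If \<open>c + u\<close> has an error of at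
  most \<open>L\<close>, then \<open>\<parallel>c i + u i\<parallel> \<le> \<parallel>c i\<parallel>\<close> on \<open>I1\<close>, where \<open>f i \<noteq> 0\<close>. The Pythagorean identity leaves
  only \<open>u = 0\<close>: the canonical dual is optimal, and the only optimal dual (\<open>unique_optimalI\<close>).

  Assume (i). Indices in \<open>I2\<close> have room for a small change, so no \<open>u \<noteq> 0\<close> as above can avoid
  increasing the norms on \<open>I1\<close> (\<open>unique_optimal_imp_no_perturbation\<close>). A linear relation over \<open>I2\<close>
  gives such a \<open>u\<close> that vanishes on \<open>I1\<close> (\<open>unique_optimalD_independent\<close>). A vector \<open>z \<noteq> 0\<close> common to
  both spans gives one that on \<open>I1\<close> shrinks every \<open>c i\<close> along a single vector \<open>y\<close>, chosen such that
  the expansion of \<open>z\<close> over \<open>I2\<close> restores duality (\<open>unique_optimalD_span\<close>).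

  The first half of the development supplies, for the abstract scalar field, the facts that make
  \<open>adj\<close> and \<open>pinv\<close> meaningful: orthogonal projections, the Riesz representation, and existence and
  uniqueness of the pseudoinverse.
\<close>

section \<open>Conjugation and the error of a dual\<close>

lemma scalar_cnj_of_real: "scalar_cnj (of_real r) = (of_real r :: 'k::rc_field)"
proof (cases "r = 0")
  case True
  then show ?thesis using scalar_cnj_add[of "0::'k" 0] by simp
next
  case False
  have "(of_real r :: 'k) * scalar_cnj (of_real r) = of_real r * of_real r"
    using mult_scalar_cnj[of "of_real r :: 'k"] by (simp add: power2_eq_square)
  with False show ?thesis by simp
qed

lemma scalar_cnj_0 [simp]: "scalar_cnj (0::'k::rc_field) = 0"
  using scalar_cnj_of_real[of 0] by simp

lemma scalar_cnj_minus: "scalar_cnj (- x) = - scalar_cnj (x::'k::rc_field)"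
  using scalar_cnj_add[of x "- x"] by (simp add: eq_neg_iff_add_eq_0 add.commute)

lemma scalar_cnj_diff: "scalar_cnj (x - y) = scalar_cnj x - scalar_cnj (y::'k::rc_field)"
  using scalar_cnj_add[of x "- y"] by (simp add: scalar_cnj_minus)

lemma scalar_cnj_eq_0_iff [simp]: "scalar_cnj x = 0 \<longleftrightarrow> x = (0::'k::rc_field)"
  by (metis scalar_cnj_0 scalar_cnj_cnj)

lemma scalar_cnj_sum: "scalar_cnj (sum g A) = (\<Sum>a\<in>A. scalar_cnj (g a :: 'k::rc_field))"
  by (induction A rule: infinite_finite_induct) (simp_all add: scalar_cnj_add)

lemma op_error_image: "op_error N F G = Max ((\<lambda>i. norm (F i) * norm (G i)) ` {1..N})"
  by (simp only: op_error_def setcompr_eq_image Collect_mem_eq)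

lemma op_error_le_iff:
  "1 \<le> N \<Longrightarrow> op_error N F G \<le> r \<longleftrightarrow> (\<forall>i\<in>{1..N}. norm (F i) * norm (G i) \<le> r)"
  unfolding op_error_image by (subst Max_le_iff) auto

lemma le_op_error: "i \<in> {1..N} \<Longrightarrow> norm (F i) * norm (G i) \<le> op_error N F G"
  unfolding op_error_image by (rule Max_ge) auto

lemma op_error_nonneg: "1 \<le> N \<Longrightarrow> 0 \<le> op_error N F G"
  using le_op_error[of 1 N F G] by (meson atLeastAtMost_iff mult_nonneg_nonneg norm_ge_zero order_trans order_refl)

section \<open>Inner products over a real or complex field\<close>

context fd_hilbert_space
begin

lemma ip_zero_left [simp]: "ip 0 y = 0"
  using ip_add_left[of 0 0 y] by simp

lemma ip_minus_left: "ip (- x) y = - ip x y"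
  using ip_add_left[of x "- x" y] by (simp add: eq_neg_iff_add_eq_0 add.commute)

lemma ip_diff_left: "ip (x - y) z = ip x z - ip y z"
  using ip_add_left[of x "- y" z] by (simp add: ip_minus_left)

lemma ip_sum_left: "ip (sum g A) y = (\<Sum>a\<in>A. ip (g a) y)"
  by (induction A rule: infinite_finite_induct) (simp_all add: ip_add_left)

lemma ip_zero_right [simp]: "ip y 0 = 0"
  by (subst ip_commute) simp

lemma ip_add_right: "ip x (y + z) = ip x y + ip x z"
  by (subst (1 2 3) ip_commute) (simp add: ip_add_left scalar_cnj_add)

lemma ip_minus_right: "ip x (- y) = - ip x y"
  by (subst (1 2) ip_commute) (simp add: ip_minus_left scalar_cnj_minus)

lemma ip_diff_right: "ip x (y - z) = ip x y - ip x z"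
  using ip_add_right[of x y "- z"] by (simp add: ip_minus_right)

lemma ip_smul_right: "ip x (smul c y) = scalar_cnj c * ip x y"
  by (subst (1 2) ip_commute) (simp add: ip_smul_left scalar_cnj_mult)

lemma ip_eq_0_commute: "ip x y = 0 \<Longrightarrow> ip y x = 0"
  by (subst ip_commute) simp

lemma ip_self_eq_0_iff [simp]: "ip x x = 0 \<longleftrightarrow> x = 0"
  by (simp add: ip_self)

lemma ip_extI: "(\<And>z. ip z x = ip z y) \<Longrightarrow> x = y"
  using ip_self_eq_0_iff[of "x - y"] by (simp add: ip_diff_right)

lemma norm_smul: "norm (smul c x) = norm c * norm x"
proof -
  have "(of_real ((norm (smul c x))\<^sup>2) :: 'k) = (c * scalar_cnj c) * of_real ((norm x)\<^sup>2)"
    by (simp only: ip_self[symmetric] ip_smul_left ip_smul_right mult_ac)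
  also have "\<dots> = of_real ((norm c * norm x)\<^sup>2)"
    by (simp only: mult_scalar_cnj power_mult_distrib of_real_mult)
  finally have "(norm (smul c x))\<^sup>2 = (norm c * norm x)\<^sup>2"
    by (simp only: of_real_eq_iff)
  then show ?thesis by (simp add: power2_eq_iff_nonneg)
qed

text \<open>
  Subtracting a real multiple \<open>t\<close> of \<open>\<langle>x, y\<rangle> y\<close> does not increase the norm as long as
  \<open>0 \<le> t\<close> and \<open>t \<parallel>y\<parallel>\<^sup>2 \<le> 2\<close>. This gives the Cauchy--Schwarz inequality, and it is also what keeps the
  perturbed dual below the canonical one in \<open>unique_optimalD_span\<close>.
\<close>

lemma norm_diff_smul_ip_sq:
  "(norm (x - smul (of_real t * ip x y) y))\<^sup>2 =
     (norm x)\<^sup>2 - t * (2 - t * (norm y)\<^sup>2) * (norm (ip x y))\<^sup>2"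
proof -
  let ?a = "ip x y"
  have "(of_real ((norm (x - smul (of_real t * ?a) y))\<^sup>2) :: 'k) =
      ip x x - 2 * of_real t * (?a * scalar_cnj ?a) + of_real t * of_real t * (?a * scalar_cnj ?a) * ip y y"
    by (simp add: ip_self[symmetric] ip_diff_left ip_diff_right ip_smul_left ip_smul_right
        scalar_cnj_mult scalar_cnj_of_real ip_commute[of y x] algebra_simps del: of_real_power)
  also have "\<dots> = of_real ((norm x)\<^sup>2 - t * (2 - t * (norm y)\<^sup>2) * (norm ?a)\<^sup>2)"
    unfolding mult_scalar_cnj ip_self by (simp add: algebra_simps)
  finally show ?thesis by (simp only: of_real_eq_iff)
qed

lemma cauchy_schwarz: "norm (ip x y) \<le> norm x * norm y"
proof (cases "y = 0")
  case False
  define t where "t = 1 / (norm y)\<^sup>2"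
  have t: "t * (norm y)\<^sup>2 = 1" "t > 0" using False by (auto simp: t_def)
  have "0 \<le> (norm x)\<^sup>2 - t * (norm (ip x y))\<^sup>2"
    using norm_diff_smul_ip_sq[of x t y] t(1)
    by (metis mult.right_neutral one_add_one add_diff_cancel_right' zero_le_power2)
  then have "(norm (ip x y))\<^sup>2 \<le> (norm x * norm y)\<^sup>2"
    using False by (simp add: t_def field_simps)
  then show ?thesis by (simp add: power2_le_iff_abs_le)
qed simp

section \<open>Projections, functionals and adjoints\<close>

lemma finite_spanning_set:
  assumes "subspace S"
  obtains B where "finite B" "independent B" "span B = S"
proof -
  obtain B0 where B0: "finite B0" "independent B0" "span B0 = UNIV"
    using basis_exists by blast
  interpret fin: finite_dimensional_vector_space smul B0
    using B0 by unfold_locales auto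
  obtain B where B: "B \<subseteq> S" "independent B" "S \<subseteq> span B"
    using maximal_independent_subset by blast
  have "finite B" using fin.finiteI_independent B by blast
  moreover have "span B = S"
    using B assms span_minimal by blast
  ultimately show ?thesis using B that by blast
qed

text \<open>
  Gram--Schmidt, organised as an induction over a spanning set: adding \<open>b\<close> to \<open>B\<close> adds to the
  projection its component along the part \<open>w\<close> of \<open>b\<close> that is orthogonal to \<open>span B\<close>.
\<close>

lemma orthogonal_projection_exists:
  assumes "subspace S"
  shows "\<exists>p\<in>S. \<forall>s\<in>S. ip (x - p) s = 0"
proof -
  have *: "\<exists>p\<in>span B. \<forall>b\<in>B. ip (x - p) b = 0" if "finite B" for B x
    using that
  proof (induction B arbitrary: x)
    case (insert b B)
    obtain q where q: "q \<in> span B" "\<forall>s\<in>B. ip (b - q) s = 0" using insert.IH by blast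
    obtain p where p: "p \<in> span B" "\<forall>s\<in>B. ip (x - p) s = 0" using insert.IH by blast
    define w where "w = b - q"
    define c where "c = ip (x - p) b / ip w b"
    have sub: "span B \<subseteq> span (insert b B)" by (rule span_mono) auto
    have wspan: "w \<in> span (insert b B)"
      unfolding w_def using q(1) sub by (meson insertI1 span_base span_diff subsetD)
    have perp: "ip w s = 0" if "s \<in> span B" for s
      using that
      by (induction rule: span_induct_alt) (use q in \<open>auto simp: w_def ip_add_right ip_smul_right\<close>)
    have perp': "ip (x - p) s = 0" if "s \<in> span B" for s
      using that
      by (induction rule: span_induct_alt) (use p in \<open>auto simp: ip_add_right ip_smul_right\<close>)
    have b: "b = w + q" by (simp add: w_def)
    have wb: "ip w b = ip w w" using perp[OF q(1)] by (subst b) (simp add: ip_add_right)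
    have "ip (x - (p + smul c w)) s = 0" if "s \<in> insert b B" for s
    proof (cases "s \<in> B")
      case True
      then show ?thesis using perp[of s] perp'[of s] span_base[of s B]
        by (simp add: ip_diff_left ip_add_left ip_smul_left)
    next
      case False
      then have s: "s = b" using that by auto
      show ?thesis
      proof (cases "w = 0")
        case True
        then have "b \<in> span B" using q b by simp
        then show ?thesis using perp' s True by simp
      next
        case False
        then have "ip w b \<noteq> 0" using wb by simp
        then show ?thesis unfolding s by (simp add: ip_diff_left ip_add_left ip_smul_left c_def)
      qed
    qed
    moreover have "p + smul c w \<in> span (insert b B)"
      using p sub wspan by (intro span_add span_scale) auto
    ultimately show ?case by blast
  qed simp
  obtain B where B: "finite B" "span B = S" using finite_spanning_set[OF assms] .
  obtain p where p: "p \<in> span B" "\<forall>b\<in>B. ip (x - p) b = 0" using *[OF B(1)] by blast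
  have "ip (x - p) s = 0" if "s \<in> span B" for s
    using that
    by (induction rule: span_induct_alt) (use p in \<open>auto simp: ip_add_right ip_smul_right\<close>)
  then show ?thesis using p B by blast
qed

text \<open>
  The representing vector is a multiple of the component, orthogonal to the kernel, of any vector on
  which the functional does not vanish.
\<close>

lemma riesz_representation:
  assumes add: "\<And>x y. \<phi> (x + y) = \<phi> x + \<phi> y"
    and scale: "\<And>c x. \<phi> (smul c x) = c * \<phi> x"
  shows "\<exists>w. \<forall>x. \<phi> x = ip x w"
proof (cases "\<forall>x. \<phi> x = 0")
  case True
  then show ?thesis by (intro exI[of _ 0]) simp
next
  case False
  then obtain x where x: "\<phi> x \<noteq> 0" by blast
  have zero: "\<phi> 0 = 0" using add[of 0 0] by simp
  have diff: "\<phi> (a - b) = \<phi> a - \<phi> b" for a b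
    using add[of "a - b" b] by (simp add: algebra_simps)
  have "subspace {y. \<phi> y = 0}"
    by (auto simp: subspace_def add scale zero)
  from orthogonal_projection_exists[OF this, of x]
  obtain p where p: "\<phi> p = 0" "\<And>s. \<phi> s = 0 \<Longrightarrow> ip (x - p) s = 0" by blast
  define w where "w = x - p"
  have w: "\<phi> w = \<phi> x" by (simp add: w_def diff p)
  have wn: "w \<noteq> 0" using w x zero by auto
  have "\<phi> y = ip y (smul (scalar_cnj (\<phi> w / ip w w)) w)" for y
  proof -
    have "\<phi> (y - smul (\<phi> y / \<phi> w) w) = 0" using w x by (simp add: diff scale)
    then have "ip (y - smul (\<phi> y / \<phi> w) w) w = 0"
      unfolding w_def by (rule ip_eq_0_commute[OF p(2)])
    then have "ip y w = \<phi> y / \<phi> w * ip w w" by (simp add: ip_diff_left ip_smul_left)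
    then show ?thesis using wn w x by (simp add: ip_smul_right scalar_cnj_cnj)
  qed
  then show ?thesis by blast
qed

lemma linearI:
  assumes "\<And>x y. T (x + y) = T x + T y" "\<And>c x. T (smul c x) = smul c (T x)"
  shows "Vector_Spaces.linear smul smul T"
  by (simp add: Vector_Spaces.linear_iff assms vector_space_axioms)

context
  fixes T :: "'h \<Rightarrow> 'h"
  assumes linT: "Vector_Spaces.linear smul smul T"
begin

lemma lin_add: "T (x + y) = T x + T y"
  and lin_smul: "T (smul c x) = smul c (T x)"
  using linT by (auto simp: Vector_Spaces.linear_iff)

lemma lin_0: "T 0 = 0" using lin_add[of 0 0] by simp

lemma lin_diff: "T (x - y) = T x - T y"
  using lin_add[of "x - y" y] by (simp add: algebra_simps)

lemma lin_sum: "T (sum g A) = (\<Sum>a\<in>A. T (g a))"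
  by (induction A rule: infinite_finite_induct) (simp_all add: lin_add lin_0)

lemma subspace_range: "subspace (range T)"
proof (rule subspaceI)
  show "0 \<in> range T" using lin_0 by (metis rangeI)
  show "x + y \<in> range T" if "x \<in> range T" "y \<in> range T" for x y
    using that by (auto simp flip: lin_add)
  show "smul c x \<in> range T" if "x \<in> range T" for c x
    using that by (auto simp flip: lin_smul)
qed

text \<open>
  The adjoint is a definite description; the Riesz representation supplies its existence and the
  nondegeneracy of the inner product its uniqueness.
\<close>

lemma ip_adj: "ip (T x) y = ip x (adj ip T y)"
proof -
  have "\<exists>w. \<forall>x. ip (T x) y = ip x w" for y
    by (rule riesz_representation) (simp_all add: lin_add lin_smul ip_add_left ip_smul_left)
  then obtain S where S: "\<And>x y. ip (T x) y = ip x (S y)" by metis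
  have "\<exists>!S. \<forall>x y. ip (T x) y = ip x (S y)"
  proof (rule ex1I)
    show "\<forall>x y. ip (T x) y = ip x (S y)" using S by blast
    show "S' = S" if "\<forall>x y. ip (T x) y = ip x (S' y)" for S'
      using that S by (intro ext ip_extI) metis
  qed
  from theI'[OF this] show ?thesis unfolding adj_def by blast
qed

lemma adj_ip: "ip (adj ip T x) y = ip x (T y)"
  by (metis ip_adj ip_commute)

lemma adj_eq_self_iff: "adj ip T = T \<longleftrightarrow> (\<forall>x y. ip (T x) y = ip x (T y))"
  using ip_adj by (metis ext ip_extI)

text \<open>
  Expand in a basis; by Riesz the coordinates are inner products with fixed vectors, and so are
  bounded by Cauchy--Schwarz.
\<close>

lemma linear_bounded: "\<exists>c. \<forall>x. norm (T x) \<le> c * norm x"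
proof -
  obtain B where B: "finite B" "independent B" "span B = UNIV"
    using basis_exists by blast
  have "\<exists>w. \<forall>x. representation B x b = ip x w" for b
    by (rule riesz_representation)
      (use B in \<open>simp_all add: representation_add representation_scale\<close>)
  then obtain w where w: "\<And>b x. representation B x b = ip x (w b)" by metis
  have "norm (T x) \<le> (\<Sum>b\<in>B. norm (w b) * norm (T b)) * norm x" for x
  proof -
    have "x = (\<Sum>b\<in>B. smul (ip x (w b)) b)"
      using sum_representation_eq[of B x B] B w by auto
    then have "T x = T (\<Sum>b\<in>B. smul (ip x (w b)) b)"
      by (rule arg_cong)
    then have "T x = (\<Sum>b\<in>B. smul (ip x (w b)) (T b))"
      by (simp add: lin_sum lin_smul)
    then have "norm (T x) \<le> (\<Sum>b\<in>B. norm (ip x (w b)) * norm (T b))"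
      by (metis (no_types, lifting) norm_smul norm_sum sum.cong)
    also have "\<dots> \<le> (\<Sum>b\<in>B. (norm x * norm (w b)) * norm (T b))"
      by (intro sum_mono mult_right_mono cauchy_schwarz) auto
    also have "\<dots> = (\<Sum>b\<in>B. norm (w b) * norm (T b)) * norm x"
      by (simp add: sum_distrib_left sum_distrib_right mult_ac)
    finally show ?thesis .
  qed
  then show ?thesis by blast
qed

end

section \<open>The Moore--Penrose pseudoinverse\<close>

text \<open>
  The body repeats the predicate inside the definite description \<open>pinv\<close>, so that existence and
  uniqueness of the pseudoinverse can be stated separately.
\<close>

definition penrose :: "('h \<Rightarrow> 'h) \<Rightarrow> ('h \<Rightarrow> 'h) \<Rightarrow> bool" where
  "penrose T X \<longleftrightarrow> bounded_operator smul X \<and>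
     T \<circ> X \<circ> T = T \<and> X \<circ> T \<circ> X = X \<and> adj ip (T \<circ> X) = T \<circ> X \<and> adj ip (X \<circ> T) = X \<circ> T"

text \<open>
  Self-adjointness of the two products becomes a symmetry of the inner product, which can be used
  without referring to the adjoint operator.
\<close>

lemma penrose_iff:
  assumes T: "Vector_Spaces.linear smul smul T"
  shows "penrose T X \<longleftrightarrow> Vector_Spaces.linear smul smul X \<and>
     (\<forall>x. T (X (T x)) = T x) \<and> (\<forall>x. X (T (X x)) = X x) \<and>
     (\<forall>x y. ip (T (X x)) y = ip x (T (X y))) \<and> (\<forall>x y. ip (X (T x)) y = ip x (X (T y)))"
proof (cases "Vector_Spaces.linear smul smul X")
  case True
  then have "Vector_Spaces.linear smul smul (T \<circ> X)" "Vector_Spaces.linear smul smul (X \<circ> T)"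
    using T by (auto intro!: linearI simp: lin_add lin_smul)
  from this[THEN adj_eq_self_iff] True linear_bounded[OF True] show ?thesis
    by (auto simp: penrose_def bounded_operator_def fun_eq_iff)
qed (simp add: penrose_def bounded_operator_def)

text \<open>
  For each \<open>y\<close>, let \<open>X y\<close> be the vector orthogonal to \<open>ker T\<close> that \<open>T\<close> maps to the
  orthogonal projection of \<open>y\<close> onto \<open>range T\<close>. These two properties determine \<open>X y\<close>, which
  makes \<open>X\<close> linear and yields the four Penrose equations.
\<close>

lemma penrose_exists:
  assumes T: "Vector_Spaces.linear smul smul T"
  shows "\<exists>X. penrose T X"
proof -
  note T_simps = lin_add[OF T] lin_smul[OF T] lin_0[OF T] lin_diff[OF T]
  from orthogonal_projection_exists[OF subspace_range[OF T]]
  have "\<forall>y. \<exists>x. \<forall>v. ip (y - T x) (T v) = 0" by blast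
  then obtain R where R: "\<And>y v. ip (y - T (R y)) (T v) = 0" by metis
  have ker: "subspace {x. T x = 0}"
    by (auto simp: subspace_def T_simps)
  have "\<forall>y. \<exists>q. T q = 0 \<and> (\<forall>v. T v = 0 \<longrightarrow> ip (R y - q) v = 0)"
    using orthogonal_projection_exists[OF ker] by blast
  then obtain Q where Q: "\<And>y. T (Q y) = 0" "\<And>y v. T v = 0 \<Longrightarrow> ip (R y - Q y) v = 0" by metis
  define X where "X y = R y - Q y" for y
  have X1: "ip (y - T (X y)) (T v) = 0" for y v
    using R[of y v] Q(1) by (simp add: X_def T_simps)
  have X2: "ip (X y) v = 0" if "T v = 0" for y v
    using Q(2) that by (simp add: X_def)
  \<comment> \<open>the difference of two candidates lies in \<open>ker T\<close> and is orthogonal to it\<close>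
  have X_unique: "X y = x" if "\<And>v. ip (y - T x) (T v) = 0" "\<And>v. T v = 0 \<Longrightarrow> ip x v = 0" for x y
  proof -
    have "ip (T (X y) - T x) (T v) = 0" for v
      using X1[of y v] that(1)[of v] by (simp add: ip_diff_left)
    then have "T (X y - x) = 0"
      by (metis T_simps(4) ip_self_eq_0_iff)
    then have "ip (X y - x) (X y - x) = 0"
      using X2 that(2) by (metis diff_zero ip_diff_left)
    then show ?thesis by simp
  qed
  have linX: "Vector_Spaces.linear smul smul X"
  proof (rule linearI)
    show "X (x + y) = X x + X y" for x y
    proof (rule X_unique)
      show "ip (x + y - T (X x + X y)) (T v) = 0" for v
        using X1[of x v] X1[of y v] by (simp add: T_simps ip_diff_left ip_add_left)
    qed (simp add: ip_add_left X2)
    show "X (smul c x) = smul c (X x)" for c x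
    proof (rule X_unique)
      show "ip (smul c x - T (smul c (X x))) (T v) = 0" for v
        using X1[of x v] by (simp add: T_simps ip_diff_left ip_smul_left)
    qed (simp add: ip_smul_left X2)
  qed
  have TXT: "T (X (T x)) = T x" for x
    using X1[of "T x" "x - X (T x)"] by (simp add: T_simps)
  have XTX: "X (T (X x)) = X x" for x
    by (rule X_unique) (simp_all add: X2)
  have "ip (T (X x)) y = ip (T (X x)) (T (X y))" for x y
    using ip_eq_0_commute[OF X1[of y "X x"]] by (simp add: ip_diff_right)
  moreover have "ip x (T (X y)) = ip (T (X x)) (T (X y))" for x y
    using X1[of x "X y"] by (simp add: ip_diff_left)
  moreover have "ip (X (T x)) y = ip (X (T x)) (X (T y))" for x y
    using X2[of "y - X (T y)" "T x"] by (simp add: T_simps TXT ip_diff_right)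
  moreover have "ip x (X (T y)) = ip (X (T x)) (X (T y))" for x y
    using ip_eq_0_commute[OF X2[of "x - X (T x)" "T y"]] by (simp add: T_simps TXT ip_diff_left)
  ultimately show ?thesis using linX TXT XTX penrose_iff[OF T] by metis
qed

text \<open>
  Both \<open>T X\<close> and \<open>T Y\<close> are the orthogonal projection onto \<open>range T\<close>, both \<open>X T\<close> and
  \<open>Y T\<close> the one onto \<open>(ker T)\<^sup>\<bottom>\<close>; hence \<open>X = X T X = Y T X = Y T Y = Y\<close>.
\<close>

lemma penrose_unique:
  assumes T: "Vector_Spaces.linear smul smul T" and X: "penrose T X" and Y: "penrose T Y"
  shows "X = Y"
proof
  fix x
  note X' = X[unfolded penrose_iff[OF T]] and Y' = Y[unfolded penrose_iff[OF T]]
  have TX: "T (X u) = T (Y u)" for u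
  proof (rule ip_extI)
    fix z
    have "ip z (T (X u)) = ip z (T (Y (T (X u))))" using Y' by simp
    also have "\<dots> = ip (T (X (T (Y z)))) u" using X' Y' by metis
    also have "\<dots> = ip z (T (Y u))" using X' Y' by metis
    finally show "ip z (T (X u)) = ip z (T (Y u))" .
  qed
  have XT: "X (T u) = Y (T u)" for u
  proof (rule ip_extI)
    fix z
    have "ip z (X (T u)) = ip z (X (T (Y (T u))))" using Y' by simp
    also have "\<dots> = ip (Y (T (X (T z)))) u" using X' Y' by metis
    also have "\<dots> = ip z (Y (T u))" using X' Y' by metis
    finally show "ip z (X (T u)) = ip z (Y (T u))" .
  qed
  show "X x = Y x" using X' Y' TX XT by metis
qed

lemma pinv_penrose:
  assumes "Vector_Spaces.linear smul smul T"
  shows "penrose T (pinv smul ip T)"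
  unfolding pinv_def penrose_def[symmetric]
  using penrose_exists[OF assms] penrose_unique[OF assms] by (metis theI')

section \<open>Finite families of vectors\<close>

text \<open>
  The operator \<open>x \<mapsto> \<Sum>i. \<langle>x, u i\<rangle> a i\<close> has trace \<open>\<Sum>i. \<langle>a i, u i\<rangle>\<close>, which must therefore vanish
  when the operator does. The trace is computed in an arbitrary basis \<open>B\<close> through its coordinate
  functionals, so that no orthonormal basis is involved.
\<close>

lemma trace_of_zero_sum:
  assumes "finite A" and "\<And>x. (\<Sum>i\<in>A. smul (ip x (u i)) (a i)) = 0"
  shows "(\<Sum>i\<in>A. ip (a i) (u i)) = 0"
proof -
  obtain B where B: "finite B" "independent B" "span B = UNIV"
    using basis_exists by blast
  let ?\<rho> = "representation B"
  have "(\<Sum>i\<in>A. ip (a i) (u i)) = (\<Sum>i\<in>A. \<Sum>b\<in>B. ?\<rho> (a i) b * ip b (u i))"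
  proof (rule sum.cong[OF refl])
    fix i
    have "a i = (\<Sum>b\<in>B. smul (?\<rho> (a i) b) b)"
      using sum_representation_eq[of B "a i" B] B by simp
    then have "ip (a i) (u i) = ip (\<Sum>b\<in>B. smul (?\<rho> (a i) b) b) (u i)"
      by (rule arg_cong)
    then show "ip (a i) (u i) = (\<Sum>b\<in>B. ?\<rho> (a i) b * ip b (u i))"
      by (simp only: ip_sum_left ip_smul_left)
  qed
  also have "\<dots> = (\<Sum>b\<in>B. \<Sum>i\<in>A. ip b (u i) * ?\<rho> (a i) b)"
    by (subst sum.swap) (simp only: mult.commute)
  also have "\<dots> = (\<Sum>b\<in>B. ?\<rho> (\<Sum>i\<in>A. smul (ip b (u i)) (a i)) b)"
  proof (rule sum.cong[OF refl])
    fix b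
    show "(\<Sum>i\<in>A. ip b (u i) * ?\<rho> (a i) b) = ?\<rho> (\<Sum>i\<in>A. smul (ip b (u i)) (a i)) b"
      using B representation_sum[of B A "\<lambda>i. smul (ip b (u i)) (a i)"]
      by (simp add: representation_scale)
  qed
  also have "\<dots> = 0" by (simp add: assms(2) representation_zero)
  finally show ?thesis .
qed

lemma span_image_finite:
  assumes "finite I" "z \<in> span (g ` I)"
  obtains \<alpha> where "z = (\<Sum>i\<in>I. smul (\<alpha> i) (g i))"
proof -
  have "\<exists>\<alpha>. z = (\<Sum>i\<in>I. smul (\<alpha> i) (g i))" using assms(2)
  proof (induction rule: span_induct_alt)
    case base
    show ?case by (intro exI[of _ "\<lambda>_. 0"]) simp
  next
    case (step c x y)
    then obtain j \<alpha> where "j \<in> I" "x = g j" "y = (\<Sum>i\<in>I. smul (\<alpha> i) (g i))" by blast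
    moreover have "(\<Sum>i\<in>I. smul ((if i = j then c else 0) + \<alpha> i) (g i)) =
        (\<Sum>i\<in>I. if i = j then smul c (g i) else 0) + (\<Sum>i\<in>I. smul (\<alpha> i) (g i))"
      unfolding sum.distrib[symmetric] by (rule sum.cong) (auto simp: scale_left_distrib)
    ultimately have eq: "smul c x + y = (\<Sum>i\<in>I. smul ((if i = j then c else 0) + \<alpha> i) (g i))"
      using assms(1) by simp
    show ?case by (rule exI, rule eq)
  qed
  with that show ?thesis by blast
qed

text \<open>
  Independence of the image set together with injectivity is the vanishing of all coefficients that
  are indexed by \<open>I\<close> itself, the form in which coefficient families are compared below.
\<close>

lemma independent_family_iff:
  assumes "finite I"
  shows "independent_family smul g I \<longleftrightarrow>
    (\<forall>\<alpha>. (\<Sum>i\<in>I. smul (\<alpha> i) (g i)) = 0 \<longrightarrow> (\<forall>i\<in>I. \<alpha> i = 0))"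
    (is "_ \<longleftrightarrow> ?R")
proof
  assume indep: "independent_family smul g I"
  show ?R
  proof (intro allI impI ballI)
    fix \<alpha> i
    assume sum: "(\<Sum>i\<in>I. smul (\<alpha> i) (g i)) = 0" and i: "i \<in> I"
    have inj: "inj_on g I" and ind: "independent (g ` I)"
      using indep by (auto simp: independent_family_def)
    have "(\<Sum>v\<in>g ` I. smul (\<alpha> (the_inv_into I g v)) v) = 0"
      using sum inj by (simp add: sum.reindex the_inv_into_f_f)
    then have "\<alpha> (the_inv_into I g (g i)) = 0"
      using independentD[OF ind finite_imageI[OF assms] subset_refl,
          of "\<lambda>v. \<alpha> (the_inv_into I g v)" "g i"] i by blast
    then show "\<alpha> i = 0" using inj i by (simp add: the_inv_into_f_f)
  qed
next
  assume R: ?R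
  have inj: "inj_on g I"
  proof (rule inj_onI, rule ccontr)
    fix i j assume ij: "i \<in> I" "j \<in> I" "g i = g j" "i \<noteq> j"
    \<comment> \<open>a repeated vector gives the relation \<open>g i - g j = 0\<close>\<close>
    define \<alpha> :: "nat \<Rightarrow> 'k" where "\<alpha> k = (if k = i then 1 else 0) - (if k = j then 1 else 0)" for k
    have "(\<Sum>k\<in>I. smul (\<alpha> k) (g k)) =
        (\<Sum>k\<in>I. if k = i then g k else 0) - (\<Sum>k\<in>I. if k = j then g k else 0)"
      unfolding sum_subtractf[symmetric]
      by (rule sum.cong) (auto simp: \<alpha>_def scale_left_diff_distrib)
    then have "(\<Sum>k\<in>I. smul (\<alpha> k) (g k)) = 0" using assms ij by simp
    then have "\<alpha> i = 0" using R ij by simp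
    then show False using ij by (simp add: \<alpha>_def)
  qed
  moreover have "independent (g ` I)"
  proof
    assume "dependent (g ` I)"
    from iffD1[OF dependent_finite[OF finite_imageI[OF assms]] this]
    obtain u where u: "\<exists>v\<in>g ` I. u v \<noteq> 0" "(\<Sum>v\<in>g ` I. smul (u v) v) = 0" by blast
    then obtain i where i: "i \<in> I" "u (g i) \<noteq> 0" by blast
    have "(\<Sum>i\<in>I. smul (u (g i)) (g i)) = 0" using u(2) inj by (simp add: sum.reindex)
    then have "u (g i) = 0" using R[rule_format, of "\<lambda>i. u (g i)"] i by blast
    then show False using i by blast
  qed
  ultimately show "independent_family smul g I" by (simp add: independent_family_def)
qed

text \<open>
  Every finite family is a frame for its span. If \<open>e\<close> is the component of \<open>g i\<close> orthogonal to the
  range of the frame operator \<open>S\<close>, then \<open>0 = \<langle>S e, e\<rangle> = \<Sum>j. |\<langle>e, g j\<rangle>|\<^sup>2\<close>; in particular \<open>e\<close> is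
  orthogonal to \<open>g i\<close>, and hence zero.
\<close>

lemma frame_operator_onto_span:
  assumes "finite I" and "z \<in> span (g ` I)"
  obtains w where "(\<Sum>i\<in>I. smul (ip w (g i)) (g i)) = z"
proof -
  define S where "S w = (\<Sum>i\<in>I. smul (ip w (g i)) (g i))" for w
  have S: "Vector_Spaces.linear smul smul S"
    by (rule linearI)
      (simp_all add: S_def ip_add_left ip_smul_left scale_left_distrib sum.distrib scale_sum_right)
  note sub = subspace_range[OF S]
  have "g ` I \<subseteq> range S"
  proof clarify
    fix i assume i: "i \<in> I"
    obtain p where p: "p \<in> range S" "\<forall>s\<in>range S. ip (g i - p) s = 0"
      using orthogonal_projection_exists[OF sub] by blast
    define e where "e = g i - p"
    have "ip e (S e) = 0" unfolding e_def using p(2) by blast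
    then have "ip (S e) e = 0" by (rule ip_eq_0_commute)
    moreover have "ip (S e) e = (\<Sum>j\<in>I. ip e (g j) * scalar_cnj (ip e (g j)))"
      by (simp only: S_def ip_sum_left ip_smul_left ip_commute[symmetric])
    moreover have "\<dots> = of_real (\<Sum>j\<in>I. (norm (ip e (g j)))\<^sup>2)"
      by (simp only: mult_scalar_cnj of_real_sum)
    ultimately have "(of_real (\<Sum>j\<in>I. (norm (ip e (g j)))\<^sup>2) :: 'k) = 0" by (simp only:)
    then have "(\<Sum>j\<in>I. (norm (ip e (g j)))\<^sup>2) = 0" by (simp only: of_real_eq_0_iff)
    then have "ip e (g i) = 0" using assms(1) i by (simp add: sum_nonneg_eq_0_iff)
    moreover have "ip e p = 0" unfolding e_def using p by blast
    ultimately have "ip e e = 0" by (simp add: e_def ip_diff_right)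
    then show "g i \<in> range S" using p by (simp add: e_def)
  qed
  then have "z \<in> range S" using span_minimal[OF _ sub] assms(2) by blast
  then show ?thesis using that by (auto simp: S_def)
qed

section \<open>Perturbing an optimal dual\<close>

text \<open>
  A family \<open>u\<close> with \<open>\<Sum>i. \<langle>x, u i\<rangle> f i = 0\<close> is a direction along which a dual may be moved. At indices
  where the error of \<open>c\<close> is below the maximum, a short move keeps it below. So if the move does not
  increase the norms at the maximal indices either, then \<open>c + t u\<close> is again optimal for small
  \<open>t > 0\<close>, and uniqueness forces \<open>u = 0\<close>. Both necessary conditions of the theorem come from this.
\<close>

lemma unique_optimal_imp_no_perturbation:
  assumes opt: "unique_one_erasure_optimal smul ip K N f c" and N: "1 \<le> N"
    and null: "\<And>x. (\<Sum>i=1..N. smul (ip x (u i)) (f i)) = 0"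
    and maxi: "\<And>i. i \<in> {1..N} \<Longrightarrow> norm (f i) * norm (c i) = op_error N f c \<Longrightarrow>
        \<forall>\<^sub>F t in at_right 0. norm (c i + t *\<^sub>R u i) \<le> norm (c i)"
    and i: "i \<in> {1..N}"
  shows "u i = 0"
proof -
  let ?L = "op_error N f c"
  have "\<forall>\<^sub>F t in at_right 0. norm (f i) * norm (c i + t *\<^sub>R u i) \<le> ?L" if i: "i \<in> {1..N}" for i
  proof (cases "norm (f i) * norm (c i) = ?L")
    case True
    show ?thesis using maxi[OF i True]
      by eventually_elim (use True in \<open>metis mult_left_mono norm_ge_zero\<close>)
  next
    case False
    have "((\<lambda>t. norm (f i) * norm (c i + t *\<^sub>R u i)) \<longlongrightarrow> norm (f i) * norm (c i + 0 *\<^sub>R u i)) (at_right 0)"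
      by (intro tendsto_intros)
    moreover have "norm (f i) * norm (c i + 0 *\<^sub>R u i) < ?L"
      using False le_op_error[OF i, of f c] by simp
    ultimately have "\<forall>\<^sub>F t in at_right 0. norm (f i) * norm (c i + t *\<^sub>R u i) < ?L"
      by (rule order_tendstoD)
    then show ?thesis by eventually_elim simp
  qed
  then have "\<forall>\<^sub>F t in at_right 0. \<forall>i\<in>{1..N}. norm (f i) * norm (c i + t *\<^sub>R u i) \<le> ?L"
    by (intro eventually_ball_finite) auto
  moreover have "\<forall>\<^sub>F t in at_right 0. (0::real) < t"
    by (simp add: eventually_at_right_less)
  ultimately obtain t where t: "0 < t" "\<forall>i\<in>{1..N}. norm (f i) * norm (c i + t *\<^sub>R u i) \<le> ?L"
    by (metis (mono_tags, lifting) eventually_conj eventually_happens' trivial_limit_at_right_real)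
  define G where "G i = c i + smul (of_real t) (u i)" for i
  have GL: "op_error N f G \<le> ?L"
    using t N by (simp add: op_error_le_iff G_def smul_of_real)
  have copt: "K_dual smul ip K N f c" "?L = Inf {op_error N f G | G. K_dual smul ip K N f G}"
    using opt by (auto simp: unique_one_erasure_optimal_def one_erasure_optimal_def)
  have Gdual: "K_dual smul ip K N f G"
    unfolding K_dual_def
  proof
    fix x
    have "(\<Sum>i=1..N. smul (ip x (G i)) (f i)) =
        (\<Sum>i=1..N. smul (ip x (c i)) (f i)) + smul (of_real t) (\<Sum>i=1..N. smul (ip x (u i)) (f i))"
      by (simp add: G_def ip_add_right ip_smul_right scalar_cnj_of_real scale_left_distrib
          sum.distrib scale_sum_right)
    then show "K x = (\<Sum>i=1..N. smul (ip x (G i)) (f i))"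
      using copt(1) null by (simp add: K_dual_def)
  qed
  have "?L \<le> op_error N f G"
    unfolding copt(2)
    by (rule cInf_lower) (use Gdual op_error_nonneg[OF N] in \<open>auto intro!: bdd_belowI[of _ 0]\<close>)
  then have "one_erasure_optimal smul ip K N f G"
    using GL Gdual copt(2) by (simp add: one_erasure_optimal_def)
  then have "G i = c i" using opt i by (simp add: unique_one_erasure_optimal_def)
  then show ?thesis using t by (simp add: G_def smul_of_real)
qed

section \<open>The canonical dual of a Parseval K-frame\<close>

text \<open>
  The difference \<open>D\<close> of the two sides is self-adjoint, and the Parseval identity says that its quadratic
  form vanishes. Over \<open>\<real>\<close> as well as over \<open>\<complex>\<close>, such an operator is zero: evaluate the form at
  \<open>x + D x\<close>.
\<close>

lemma parseval_frame_operator: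
  assumes K: "Vector_Spaces.linear smul smul K" and F: "parseval_K_frame ip K N f"
  shows "(\<Sum>i=1..N. smul (ip x (f i)) (f i)) = K (adj ip K x)"
proof -
  define D where "D x = (\<Sum>i=1..N. smul (ip x (f i)) (f i)) - K (adj ip K x)" for x
  have ipD: "ip (D x) y = (\<Sum>i=1..N. ip x (f i) * ip (f i) y) - ip (adj ip K x) (adj ip K y)" for x y
    by (simp add: D_def ip_diff_left ip_sum_left ip_smul_left ip_adj[OF K])
  have adj_add: "adj ip K (x + y) = adj ip K x + adj ip K y" for x y
    by (rule ip_extI) (simp add: ip_adj[OF K, symmetric] ip_add_right)
  have diag: "ip (D x) x = 0" for x
  proof -
    have "(\<Sum>i=1..N. ip x (f i) * ip (f i) x) = of_real (\<Sum>i=1..N. (norm (ip x (f i)))\<^sup>2)"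
      by (simp only: ip_commute[of "f _" x] mult_scalar_cnj of_real_sum)
    also have "\<dots> = ip (adj ip K x) (adj ip K x)"
      using F by (simp add: parseval_K_frame_def ip_self)
    finally show ?thesis by (simp add: ipD)
  qed
  have D_add: "ip (D (x + y)) z = ip (D x) z + ip (D y) z" for x y z
    by (simp add: ipD adj_add ip_add_left sum.distrib distrib_right)
  have D_herm: "ip (D x) y = scalar_cnj (ip (D y) x)" for x y
    by (simp only: ipD scalar_cnj_diff scalar_cnj_sum scalar_cnj_mult ip_commute[symmetric] mult.commute)
  have "ip (D (D x)) x + ip (D x) (D x) = 0"
    using diag[of "x + D x"] by (simp only: D_add ip_add_right diag add_0_left add_0_right)
  moreover have "ip (D (D x)) x = ip (D x) (D x)"
    using D_herm[of "D x" x] by (simp only: ip_commute[symmetric])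
  ultimately have "ip (D x) (D x) = 0" by simp
  then show ?thesis by (simp add: D_def)
qed

context
  fixes K :: "'h \<Rightarrow> 'h" and N :: nat and f :: "nat \<Rightarrow> 'h" and c :: "nat \<Rightarrow> 'h"
  assumes K: "Vector_Spaces.linear smul smul K" and F: "parseval_K_frame ip K N f"
    and c_def: "c \<equiv> \<lambda>i. pinv smul ip K (f i)"
begin

lemmas pinvK = pinv_penrose[OF K, unfolded penrose_iff[OF K]]

text \<open>
  The frame vectors lie in \<open>range K\<close>, onto which \<open>K K\<^sup>\<dagger>\<close> projects. Indeed the component \<open>e\<close> of
  \<open>f i\<close> orthogonal to \<open>range K\<close> satisfies \<open>K\<^sup>* e = 0\<close>, so by the Parseval identity it is orthogonal to
  \<open>f i\<close>.
\<close>

lemma K_canonical: "i \<in> {1..N} \<Longrightarrow> K (c i) = f i"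
proof -
  assume i: "i \<in> {1..N}"
  define e where "e = f i - K (c i)"
  have "ip (adj ip K e) x = 0" for x
  proof -
    have "ip (adj ip K e) x = ip (f i) (K x) - ip (K (pinv smul ip K (f i))) (K x)"
      by (simp add: adj_ip[OF K] e_def c_def ip_diff_left)
    also have "\<dots> = 0" using pinvK by simp
    finally show ?thesis .
  qed
  then have "adj ip K e = 0" using ip_self_eq_0_iff by blast
  then have "(\<Sum>i=1..N. (norm (ip e (f i)))\<^sup>2) = 0" and e0: "\<And>x. ip e (K x) = 0"
    using F adj_ip[OF K, of e] by (auto simp: parseval_K_frame_def)
  then have "ip e (f i) = 0" using i by (subst (asm) sum_nonneg_eq_0_iff) auto
  then have "ip e e = 0" using e0 by (simp add: e_def ip_diff_right)
  then show ?thesis by (simp add: e_def)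
qed

text \<open>
  \<open>\<Sum>i. \<langle>x, K\<^sup>\<dagger> f i\<rangle> f i\<close> is the frame operator \<open>K K\<^sup>*\<close> applied to \<open>(K\<^sup>\<dagger>)\<^sup>* x\<close>, and
  \<open>K\<^sup>* (K\<^sup>\<dagger>)\<^sup>* = (K\<^sup>\<dagger> K)\<^sup>* = K\<^sup>\<dagger> K\<close>.
\<close>

lemma canonical_K_dual: "K_dual smul ip K N f c"
  unfolding K_dual_def
proof
  fix x
  let ?X = "pinv smul ip K"
  have X: "Vector_Spaces.linear smul smul ?X" using pinvK by blast
  have "(\<Sum>i=1..N. smul (ip x (c i)) (f i)) = (\<Sum>i=1..N. smul (ip (adj ip ?X x) (f i)) (f i))"
    by (simp add: c_def adj_ip[OF X])
  also have "\<dots> = K (adj ip K (adj ip ?X x))" by (rule parseval_frame_operator[OF K F])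
  also have "adj ip K (adj ip ?X x) = ?X (K x)"
    by (rule ip_extI) (use pinvK in \<open>simp add: ip_adj[OF K, symmetric] ip_adj[OF X, symmetric]\<close>)
  also have "K (?X (K x)) = K x" using pinvK by simp
  finally show "K x = (\<Sum>i=1..N. smul (ip x (c i)) (f i))" ..
qed

lemma canonical_error_pos:
  assumes "K \<noteq> (\<lambda>x. 0)"
  shows "1 \<le> N" "0 < op_error N f c"
proof -
  obtain x where x: "K x \<noteq> 0" using assms by auto
  have "K x = (\<Sum>i=1..N. smul (ip x (c i)) (f i))"
    using canonical_K_dual by (simp add: K_dual_def)
  then have "(\<Sum>i=1..N. smul (ip x (c i)) (f i)) \<noteq> 0" using x by simp
  then obtain i where i: "i \<in> {1..N}" "smul (ip x (c i)) (f i) \<noteq> 0"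
    by (rule sum.not_neutral_contains_not_neutral)
  then show "1 \<le> N" by simp
  have "f i \<noteq> 0" "c i \<noteq> 0" using i by auto
  then show "0 < op_error N f c"
    using le_op_error[OF i(1), of f c] by (meson less_le_trans mult_pos_pos zero_less_norm_iff)
qed

text \<open>
  The canonical dual is orthogonal, in the space of families, to every difference \<open>u\<close> of two duals:
  applying \<open>K\<^sup>\<dagger>\<close> to \<open>\<Sum>i. \<langle>x, u i\<rangle> f i = 0\<close> gives \<open>\<Sum>i. \<langle>x, u i\<rangle> c i = 0\<close>, whose trace is
  \<open>\<Sum>i. \<langle>c i, u i\<rangle>\<close>. The two mixed terms in the expansion of the squares therefore cancel.
\<close>

lemma dual_pythagoras:
  assumes null: "\<And>x. (\<Sum>i=1..N. smul (ip x (u i)) (f i)) = 0"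
  shows "(\<Sum>i=1..N. (norm (c i + u i))\<^sup>2) = (\<Sum>i=1..N. (norm (c i))\<^sup>2) + (\<Sum>i=1..N. (norm (u i))\<^sup>2)"
proof -
  let ?X = "pinv smul ip K"
  have X: "Vector_Spaces.linear smul smul ?X" using pinvK by blast
  have "(\<Sum>i=1..N. smul (ip x (u i)) (c i)) = 0" for x
    using arg_cong[OF null, of ?X x] by (simp add: lin_sum[OF X] lin_smul[OF X] lin_0[OF X] c_def)
  then have tr: "(\<Sum>i=1..N. ip (c i) (u i)) = 0" by (rule trace_of_zero_sum[OF finite_atLeastAtMost])
  have "scalar_cnj (\<Sum>i=1..N. ip (c i) (u i)) = 0" by (simp only: tr scalar_cnj_0)
  then have tr': "(\<Sum>i=1..N. ip (u i) (c i)) = 0"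
    by (simp only: scalar_cnj_sum ip_commute[symmetric])
  have "(of_real (\<Sum>i=1..N. (norm (c i + u i))\<^sup>2) :: 'k) = (\<Sum>i=1..N. ip (c i + u i) (c i + u i))"
    by (simp add: ip_self)
  also have "\<dots> = (\<Sum>i=1..N. ip (c i) (c i)) + (\<Sum>i=1..N. ip (u i) (u i))"
    using tr tr' by (simp add: ip_add_left ip_add_right sum.distrib)
  also have "\<dots> = of_real ((\<Sum>i=1..N. (norm (c i))\<^sup>2) + (\<Sum>i=1..N. (norm (u i))\<^sup>2))"
    by (simp add: ip_self)
  finally show ?thesis by (simp only: of_real_eq_iff)
qed

section \<open>Unique optimality of the canonical dual\<close>

text \<open>
  Let \<open>G\<close> be a dual with an error no larger than that of \<open>c\<close>. Trivial intersection and independence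
  confine the support of \<open>u = G - c\<close> to \<open>I1\<close>, where the error bound says \<open>\<parallel>c i + u i\<parallel> \<le> \<parallel>c i\<parallel>\<close>; but \<open>u \<noteq> 0\<close>
  would make the sum of the squared norms increase.
\<close>

lemma unique_optimalI:
  assumes nz: "K \<noteq> (\<lambda>x. 0)"
    and I1: "I1 = {i \<in> {1..N}. norm (f i) * norm (c i) = op_error N f c}"
    and I2: "I2 = {1..N} - I1"
    and disj: "span (f ` I1) \<inter> span (f ` I2) = {0}"
    and indep: "independent_family smul f I2"
  shows "unique_one_erasure_optimal smul ip K N f c"
proof -
  note N = canonical_error_pos(1)[OF nz] and Lpos = canonical_error_pos(2)[OF nz]
  let ?L = "op_error N f c"
  have I1_sub: "I1 \<subseteq> {1..N}" by (auto simp: I1)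
  have key: "\<forall>i\<in>{1..N}. G i = c i" if G: "K_dual smul ip K N f G" and le: "op_error N f G \<le> ?L" for G
  proof -
    define u where "u i = G i - c i" for i
    have null: "(\<Sum>i=1..N. smul (ip x (u i)) (f i)) = 0" for x
      using G canonical_K_dual
      by (simp add: u_def K_dual_def ip_diff_right scale_left_diff_distrib sum_subtractf)
    have u2: "u i = 0" if i: "i \<in> I2" for i
    proof -
      have "ip x (u i) = 0" for x
      proof -
        have split: "(\<Sum>i\<in>I1. smul (ip x (u i)) (f i)) + (\<Sum>i\<in>I2. smul (ip x (u i)) (f i)) = 0"
          using null[of x] sum.subset_diff[OF I1_sub finite_atLeastAtMost, of "\<lambda>i. smul (ip x (u i)) (f i)"]
          by (simp only: I2 add.commute)
        let ?z = "\<Sum>i\<in>I2. smul (ip x (u i)) (f i)"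
        \<comment> \<open>the two halves of the relation cancel, so each lies in the intersection of the spans\<close>
        have z: "?z = - (\<Sum>i\<in>I1. smul (ip x (u i)) (f i))"
          using split by (simp only: eq_neg_iff_add_eq_0 add.commute)
        have "?z \<in> span (f ` I2)" by (intro span_sum span_scale span_base imageI)
        moreover have "?z \<in> span (f ` I1)"
          unfolding z by (intro span_neg span_sum span_scale span_base imageI)
        ultimately have "?z \<in> {0}" using disj by blast
        then have "?z = 0" by blast
        moreover have "finite I2" by (simp add: I2)
        ultimately show ?thesis
          using indep[unfolded independent_family_iff[OF \<open>finite I2\<close>], rule_format, of "\<lambda>i. ip x (u i)" i] i
          by blast
      qed
      then show ?thesis using ip_self_eq_0_iff by blast
    qed
    have "norm (c i + u i) \<le> norm (c i)" if i: "i \<in> {1..N}" for i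
    proof (cases "i \<in> I2")
      case False
      then have e: "norm (f i) * norm (c i) = ?L" using i by (simp add: I1 I2)
      \<comment> \<open>dividing by \<open>\<parallel>f i\<parallel>\<close> is possible because the maximal error is positive\<close>
      then have "norm (f i) > 0" using Lpos by (metis mult_zero_left order_less_irrefl zero_less_norm_iff norm_zero)
      moreover have "norm (f i) * norm (G i) \<le> norm (f i) * norm (c i)"
        using le_op_error[OF i, of f G] le e by simp
      ultimately show ?thesis by (simp add: u_def)
    qed (simp add: u2)
    then have "(\<Sum>i=1..N. (norm (c i + u i))\<^sup>2) \<le> (\<Sum>i=1..N. (norm (c i))\<^sup>2)"
      by (intro sum_mono power_mono) auto
    then have "(\<Sum>i=1..N. (norm (u i))\<^sup>2) \<le> 0" using dual_pythagoras[OF null] by simp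
    then have "(\<Sum>i=1..N. (norm (u i))\<^sup>2) = 0" by (intro antisym sum_nonneg) auto
    then have "\<forall>i\<in>{1..N}. u i = 0" by (subst (asm) sum_nonneg_eq_0_iff) auto
    then show ?thesis by (simp add: u_def)
  qed
  have lower: "?L \<le> op_error N f G" if "K_dual smul ip K N f G" for G
  proof (rule ccontr)
    assume "\<not> ?L \<le> op_error N f G"
    then have lt: "op_error N f G < ?L" by simp
    then have "\<forall>i\<in>{1..N}. G i = c i" using key[OF that] by simp
    then have "op_error N f G = ?L"
      unfolding op_error_image by (intro arg_cong[of _ _ Max] image_cong) auto
    then show False using lt by simp
  qed
  have inf: "Inf {op_error N f G | G. K_dual smul ip K N f G} = ?L"
    by (rule cInf_eq_minimum) (use canonical_K_dual lower in auto)
  show ?thesis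
    unfolding unique_one_erasure_optimal_def one_erasure_optimal_def inf
  proof (intro conjI allI impI canonical_K_dual refl)
    fix G
    assume G: "K_dual smul ip K N f G \<and> op_error N f G = ?L"
    show "\<forall>i\<in>{1..N}. G i = c i"
      by (rule key[OF conjunct1[OF G] eq_refl[OF conjunct2[OF G]]])
  qed
qed

text \<open>
  The coefficients of a linear relation among the \<open>f i\<close>, \<open>i \<in> I2\<close>, multiplied by any fixed vector
  \<open>v \<noteq> 0\<close>, form an admissible direction that leaves the maximal indices alone.
\<close>

lemma unique_optimalD_independent:
  assumes nz: "K \<noteq> (\<lambda>x. 0)" and opt: "unique_one_erasure_optimal smul ip K N f c"
    and I2: "I2 = {i \<in> {1..N}. norm (f i) * norm (c i) \<noteq> op_error N f c}"
  shows "independent_family smul f I2"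
proof -
  have fin: "finite I2" by (simp add: I2)
  obtain v :: 'h where v: "v \<noteq> 0" using nz lin_0[OF K] by (metis ext)
  have "\<alpha> i = 0" if sum: "(\<Sum>i\<in>I2. smul (\<alpha> i) (f i)) = 0" and i: "i \<in> I2" for \<alpha> i
  proof -
    define u where "u i = (if i \<in> I2 then smul (scalar_cnj (\<alpha> i)) v else 0)" for i
    have "u i = 0"
    proof (rule unique_optimal_imp_no_perturbation[OF opt canonical_error_pos(1)[OF nz]])
      fix x
      have "(\<Sum>i=1..N. smul (ip x (u i)) (f i)) = (\<Sum>i\<in>I2. smul (ip x (u i)) (f i))"
        by (rule sum.mono_neutral_right) (auto simp: I2 u_def)
      also have "\<dots> = smul (ip x v) (\<Sum>i\<in>I2. smul (\<alpha> i) (f i))"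
        by (simp add: u_def ip_smul_right scalar_cnj_cnj scale_sum_right mult.commute)
      finally show "(\<Sum>i=1..N. smul (ip x (u i)) (f i)) = 0" using sum by simp
    next
      show "i \<in> {1..N}" using i by (simp add: I2)
    qed (simp add: u_def I2)
    then show ?thesis using i v by (simp add: u_def)
  qed
  then show ?thesis by (simp add: independent_family_iff[OF fin])
qed

text \<open>
  Given \<open>z\<close> in both spans, the direction moves mass \<open>z\<close> from \<open>I1\<close> to \<open>I2\<close>. On \<open>I1\<close> it must
  not increase any norm \<open>\<parallel>c i\<parallel>\<close>, and the natural such choice is to shrink all \<open>c i\<close> along one
  common vector \<open>y\<close>: \<open>u i = - \<langle>c i, y\<rangle> y\<close>. This contributes \<open>- \<langle>x, y\<rangle> \<Sum>i\<in>I1. \<langle>y, c i\<rangle> f i\<close>, so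
  \<open>y\<close> has to satisfy \<open>\<Sum>i\<in>I1. \<langle>y, c i\<rangle> f i = z\<close>. For \<open>y = K\<^sup>* w\<close> one has
  \<open>\<langle>y, c i\<rangle> = \<langle>w, K c i\<rangle> = \<langle>w, f i\<rangle>\<close>, and a suitable \<open>w\<close> exists since the frame operator of
  \<open>(f i)\<close>, \<open>i \<in> I1\<close>, maps onto their span. The expansion of \<open>z\<close> over \<open>I2\<close> compensates the
  contribution of \<open>I1\<close>. As this direction must be zero, all \<open>\<langle>y, c i\<rangle>\<close> with \<open>i \<in> I1\<close> vanish, and
  so does \<open>z\<close>.
\<close>

lemma unique_optimalD_span:
  assumes nz: "K \<noteq> (\<lambda>x. 0)" and opt: "unique_one_erasure_optimal smul ip K N f c"
    and I1: "I1 = {i \<in> {1..N}. norm (f i) * norm (c i) = op_error N f c}"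
    and I2: "I2 = {1..N} - I1"
  shows "span (f ` I1) \<inter> span (f ` I2) = {0}"
proof -
  have fin: "finite I1" "finite I2" by (auto simp: I1 I2)
  have "z = 0" if z1: "z \<in> span (f ` I1)" and z2: "z \<in> span (f ` I2)" for z
  proof -
    obtain w where w: "(\<Sum>i\<in>I1. smul (ip w (f i)) (f i)) = z"
      using frame_operator_onto_span[OF fin(1) z1] .
    obtain \<beta> where \<beta>: "z = (\<Sum>i\<in>I2. smul (\<beta> i) (f i))"
      using span_image_finite[OF fin(2) z2] .
    define y where "y = adj ip K w"
    have yc: "ip y (c i) = ip w (f i)" if "i \<in> I1" for i
      using that K_canonical[of i] by (simp add: y_def adj_ip[OF K] I1)
    define u where "u i = (if i \<in> I1 then - smul (ip (c i) y) y else smul (scalar_cnj (\<beta> i)) y)" for i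
    have u0: "u i = 0" if i: "i \<in> {1..N}" for i
    proof (rule unique_optimal_imp_no_perturbation[OF opt canonical_error_pos(1)[OF nz] _ _ i])
      fix x
      have "(\<Sum>i\<in>I1. smul (ip x (u i)) (f i)) = (\<Sum>i\<in>I1. smul (- ip x y) (smul (ip w (f i)) (f i)))"
        by (intro sum.cong refl)
          (simp add: u_def ip_minus_right ip_smul_right ip_commute[symmetric] yc mult.commute)
      also have "\<dots> = smul (- ip x y) z" by (simp only: w scale_sum_right[symmetric])
      finally have s1: "(\<Sum>i\<in>I1. smul (ip x (u i)) (f i)) = smul (- ip x y) z" .
      have "(\<Sum>i\<in>I2. smul (ip x (u i)) (f i)) = (\<Sum>i\<in>I2. smul (ip x y) (smul (\<beta> i) (f i)))"
        by (intro sum.cong refl)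
          (auto simp: u_def I2 ip_smul_right scalar_cnj_cnj mult.commute)
      also have "\<dots> = smul (ip x y) z" by (simp only: \<beta> scale_sum_right)
      finally have s2: "(\<Sum>i\<in>I2. smul (ip x (u i)) (f i)) = smul (ip x y) z" .
      have "(\<Sum>i=1..N. smul (ip x (u i)) (f i)) =
          (\<Sum>i\<in>I2. smul (ip x (u i)) (f i)) + (\<Sum>i\<in>I1. smul (ip x (u i)) (f i))"
        unfolding I2 by (rule sum.subset_diff) (auto simp: I1)
      then show "(\<Sum>i=1..N. smul (ip x (u i)) (f i)) = 0" by (simp add: s1 s2)
    next
      fix i assume "i \<in> {1..N}" "norm (f i) * norm (c i) = op_error N f c"
      then have i: "i \<in> I1" by (simp add: I1)
      have "((\<lambda>t. t * (norm y)\<^sup>2) \<longlongrightarrow> 0 * (norm y)\<^sup>2) (at_right 0)"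
        by (intro tendsto_intros)
      then have "\<forall>\<^sub>F t in at_right 0. t * (norm y)\<^sup>2 < 2"
        by (rule order_tendstoD) simp
      moreover have "\<forall>\<^sub>F t in at_right 0. (0::real) < t"
        by (simp add: eventually_at_right_less)
      ultimately show "\<forall>\<^sub>F t in at_right 0. norm (c i + t *\<^sub>R u i) \<le> norm (c i)"
      proof eventually_elim
        case (elim t)
        have "c i + t *\<^sub>R u i = c i - smul (of_real t * ip (c i) y) y"
          using i by (simp add: u_def smul_of_real[symmetric] scale_minus_right)
        then have "(norm (c i + t *\<^sub>R u i))\<^sup>2 \<le> (norm (c i))\<^sup>2"
          using elim by (simp add: norm_diff_smul_ip_sq)
        then show ?case by simp
      qed
    qed
    have "smul (ip w (f i)) (f i) = 0" if i: "i \<in> I1" for i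
    proof -
      have "smul (ip (c i) y) y = 0" using u0[of i] i by (simp add: u_def I1)
      then have "ip (c i) y = 0" by auto
      then have "ip y (c i) = 0" by (rule ip_eq_0_commute)
      then show ?thesis using yc[OF i] by simp
    qed
    then have "(\<Sum>i\<in>I1. smul (ip w (f i)) (f i)) = 0" by (rule sum.neutral[rule_format])
    then show "z = 0" by (simp only: w)
  qed
  then show ?thesis using span_zero by blast
qed

end

end

theorem theorem4p5:
  fixes smul :: "'k::rc_field \<Rightarrow> 'h::banach \<Rightarrow> 'h"
    and ip :: "'h \<Rightarrow> 'h \<Rightarrow> 'k"
    and n N :: nat
    and K :: "'h \<Rightarrow> 'h"
    and f :: "nat \<Rightarrow> 'h"
    and L :: real
    and I1 I2 :: "nat set"
    and V1 V2 :: "'h set"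
  assumes "fd_hilbert_space smul ip n"
    and "bounded_operator smul K"
    and "K \<noteq> (\<lambda>x. 0)"
    and "parseval_K_frame ip K N f"
    and "L = Max {norm (f i) * norm (pinv smul ip K (f i)) | i. i \<in> {1..N}}"
    and "I1 = {i \<in> {1..N}. norm (f i) * norm (pinv smul ip K (f i)) = L}"
    and "I2 = {1..N} - I1"
    and "V1 = module.span smul (f ` I1)"
    and "V2 = module.span smul (f ` I2)"
  shows "unique_one_erasure_optimal smul ip K N f (\<lambda>i. pinv smul ip K (f i)) \<longleftrightarrow>
         V1 \<inter> V2 = {0} \<and> independent_family smul f I2"
proof -
  interpret fd_hilbert_space smul ip n by fact
  have K: "Vector_Spaces.linear smul smul K"
    using assms(2) by (simp add: bounded_operator_def)
  let ?c = "\<lambda>i. pinv smul ip K (f i)"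
  have L: "L = op_error N f ?c" using assms(5) by (simp add: op_error_def)
  note I1 = assms(6)[unfolded L]
  have I2: "I2 = {i \<in> {1..N}. norm (f i) * norm (?c i) \<noteq> op_error N f ?c}"
    using assms(7) I1 by auto
  show ?thesis
    unfolding assms(8,9)
    using unique_optimalI[OF K assms(4) reflexive assms(3) I1 assms(7)]
      unique_optimalD_independent[OF K assms(4) reflexive assms(3) _ I2]
      unique_optimalD_span[OF K assms(4) reflexive assms(3) _ I1 assms(7)]
    by blast
qed

end
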